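(* Let $\beta\in(0,1]$, $0\le a<b$, and let $f:[a,b]\to\mathbb{R}$ be $\beta$-fractional differentiable on $[a,b]$. If $D^{\beta}f$ is increasing and $f$ is decreasing on $[a,b]$, then $$f\left(\frac{a+b}{2}\right)\le\frac{\beta}{\left(b+\frac{1}{\Gamma(\beta)}\right)^{\beta}-\left(a+\frac{1}{\Gamma(\beta)}\right)^{\beta}}\int_a^b f(t)\,d_\beta t\le f(b)+f(a)-f\left(\frac{a+b}{2}\right).$$
   Context: For $\beta\in(0,1]$, the $\beta$-derivative of a function $f$ at $x\ge 0$ is $D^{\beta}f(x)=\lim_{\varepsilon\to0}\frac{f\left(x+\varepsilon\left(x+\frac{1}{\Gamma(\beta)}\right)^{1-\beta}\right)-f(x)}{\varepsilon}$ when the limit exists (one-sided at an endpoint of the domain of $f$); $f$ is $\beta$-fractional differentiable if this limit exists at every point of the domain. The $\beta$-integral is $\int_a^b h(t)\,d_\beta t:=\int_a^b\left(t+\frac{1}{\Gamma(\beta)}\right)^{\beta-1}h(t)\,dt$. "Increasing" and "decreasing" are meant in the weak (non-strict) sense. *)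

theory Defs
  imports "HOL-Analysis.Analysis"
begin

text \<open>A function with domain \<open>S\<close> is a total function of which only the values on \<open>S\<close> are used:
  the increment \<open>\<epsilon>\<close> ranges over those reals for which the shifted point lies in \<open>S\<close>.  For a closed
  interval this is the two-sided limit at interior points and the one-sided limit at endpoints.\<close>

definition has_beta_derivative ::
  "real \<Rightarrow> real set \<Rightarrow> (real \<Rightarrow> real) \<Rightarrow> real \<Rightarrow> real \<Rightarrow> bool" where
  "has_beta_derivative \<beta> S f x L \<longleftrightarrow>
     ((\<lambda>\<epsilon>. (f (x + \<epsilon> * (x + 1 / Gamma \<beta>) powr (1 - \<beta>)) - f x) / \<epsilon>) \<longlongrightarrow> L)
       (at 0 within {\<epsilon>. x + \<epsilon> * (x + 1 / Gamma \<beta>) powr (1 - \<beta>) \<in> S})"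

definition beta_differentiable_on ::
  "real \<Rightarrow> real set \<Rightarrow> (real \<Rightarrow> real) \<Rightarrow> bool" where
  "beta_differentiable_on \<beta> S f \<longleftrightarrow> (\<forall>x\<in>S. \<exists>L. has_beta_derivative \<beta> S f x L)"

definition beta_deriv :: "real \<Rightarrow> real set \<Rightarrow> (real \<Rightarrow> real) \<Rightarrow> real \<Rightarrow> real" where
  "beta_deriv \<beta> S f x = (THE L. has_beta_derivative \<beta> S f x L)"

definition beta_integral :: "real \<Rightarrow> real \<Rightarrow> real \<Rightarrow> (real \<Rightarrow> real) \<Rightarrow> real" where
  "beta_integral \<beta> a b h = integral {a..b} (\<lambda>t. (t + 1 / Gamma \<beta>) powr (\<beta> - 1) * h t)"

end

theory Submission
  imports Defs
begin

text \<open>With \<open>c = 1 / Gamma \<beta>\<close> and \<open>u t = (t + c) powr \<beta>\<close>, the weight of the \<open>\<beta>\<close>-integral is \<open>u' / \<beta>\<close> and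
  \<open>f' = D * u' / \<beta>\<close> for the \<open>\<beta>\<close>-derivative \<open>D\<close>.  Hence monotonicity of \<open>D\<close> says that \<open>f\<close> is a convex
  function of \<open>u\<close>, and the claim is the Hermite-Hadamard inequality in the variable \<open>u\<close>, except that
  the midpoint of \<open>[a, b]\<close> replaces that of \<open>[u a, u b]\<close>.  Since \<open>u\<close> is concave, the former is the larger
  one, which only helps because \<open>f\<close> is decreasing.\<close>

text \<open>Substitute \<open>\<epsilon> = (y - x) / k\<close>, where \<open>k > 0\<close> is the
  factor \<open>(x + 1 / Gamma \<beta>) powr (1 - \<beta>)\<close>. Then \<open>y\<close> stays in
  \<open>S\<close> exactly when \<epsilon> is admissible, so one-sided limits match, and the
  difference quotient changes only by the factor \<open>k\<close>.\<close>

lemma has_beta_derivative_imp_DERIV: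
  fixes \<beta> x L :: real
  assumes L: "has_beta_derivative \<beta> S f x L"
    and pos: "0 < x + 1 / Gamma \<beta>" and "x \<in> S"
  shows "(f has_real_derivative L * (x + 1 / Gamma \<beta>) powr (\<beta> - 1)) (at x within S)"
proof -
  define k where "k = (x + 1 / Gamma \<beta>) powr (1 - \<beta>)"
  have k: "k > 0" using pos by (simp add: k_def)
  have inv: "(x + 1 / Gamma \<beta>) powr (\<beta> - 1) = 1 / k"
    using powr_minus_divide[of "x + 1 / Gamma \<beta>" "1 - \<beta>"] by (simp add: k_def)
  have "((\<lambda>\<epsilon>. (f (x + \<epsilon> * k) - f x) / \<epsilon>) \<longlongrightarrow> L) (at 0 within {\<epsilon>. x + \<epsilon> * k \<in> S})"
    using L by (simp add: has_beta_derivative_def k_def)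
  moreover have "filterlim (\<lambda>y. (y - x) / k) (at 0 within {\<epsilon>. x + \<epsilon> * k \<in> S}) (at x within S)"
    unfolding filterlim_at
  proof
    show "\<forall>\<^sub>F y in at x within S. (y - x) / k \<in> {\<epsilon>. x + \<epsilon> * k \<in> S} \<and> (y - x) / k \<noteq> 0"
      using k by (auto simp: eventually_at_filter)
    show "((\<lambda>y. (y - x) / k) \<longlongrightarrow> 0) (at x within S)"
      using k by (auto intro!: tendsto_eq_intros)
  qed
  ultimately have "((\<lambda>y. (f (x + (y - x) / k * k) - f x) / ((y - x) / k)) \<longlongrightarrow> L) (at x within S)"
    by (rule filterlim_compose)
  then have "((\<lambda>y. (f (x + (y - x) / k * k) - f x) / ((y - x) / k) * (1 / k)) \<longlongrightarrow> L * (1 / k)) (at x within S)"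
    by (intro tendsto_intros)
  moreover have "(f (x + (y - x) / k * k) - f x) / ((y - x) / k) * (1 / k) = (f y - f x) / (y - x)" for y
    using k by simp
  ultimately show ?thesis
    by (simp add: has_field_derivative_iff inv)
qed

lemma at_within_Icc_neq_bot:
  fixes a b x :: real
  assumes "a < b" "x \<in> {a..b}"
  shows "at x within {a..b} \<noteq> bot"
proof -
  have "{a..b} \<noteq> {x}"
    using assms(1) by (metis atLeastAtMost_singleton_iff order_less_irrefl)
  then show ?thesis
    using connected_imp_perfect[of "{a..b}" x] assms(2) by (simp add: trivial_limit_within)
qed

text \<open>The \<open>THE\<close> in \<open>beta_deriv\<close> is meaningful only once the limit is
  unique. Two candidates would give two ordinary derivatives at a limit point of the interval, and
  the positive power then cancels.\<close>

lemma beta_deriv_DERIV: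
  fixes a b x \<beta> :: real
  assumes "beta_differentiable_on \<beta> {a..b} f" and "a < b" and x: "x \<in> {a..b}"
    and pos: "0 < x + 1 / Gamma \<beta>"
  shows "(f has_real_derivative beta_deriv \<beta> {a..b} f x * (x + 1 / Gamma \<beta>) powr (\<beta> - 1))
           (at x within {a..b})"
proof -
  obtain L where L: "has_beta_derivative \<beta> {a..b} f x L"
    using assms(1) x unfolding beta_differentiable_on_def by blast
  have "M = L" if M: "has_beta_derivative \<beta> {a..b} f x M" for M
  proof -
    have "M * (x + 1 / Gamma \<beta>) powr (\<beta> - 1) = L * (x + 1 / Gamma \<beta>) powr (\<beta> - 1)"
      using has_beta_derivative_imp_DERIV[OF M pos x] has_beta_derivative_imp_DERIV[OF L pos x]
        tendsto_unique[OF at_within_Icc_neq_bot[OF \<open>a < b\<close> x]]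
      unfolding has_field_derivative_iff by blast
    then show ?thesis using pos by simp
  qed
  then have "beta_deriv \<beta> {a..b} f x = L"
    unfolding beta_deriv_def using L by (intro the_equality)
  then show ?thesis
    using has_beta_derivative_imp_DERIV[OF L pos x] by simp
qed

lemma antimono_on_DERIV_nonpos:
  fixes f :: "real \<Rightarrow> real"
  assumes anti: "antimono_on S f" and der: "(f has_real_derivative d) (at x within S)"
    and "x \<in> S" and "at x within S \<noteq> bot"
  shows "d \<le> 0"
proof (rule tendsto_upperbound)
  show "((\<lambda>y. (f y - f x) / (y - x)) \<longlongrightarrow> d) (at x within S)"
    using der by (simp add: has_field_derivative_iff)
  have "(f y - f x) / (y - x) \<le> 0" if "y \<in> S" for y
    using monotone_onD[OF anti \<open>x \<in> S\<close> that] monotone_onD[OF anti that \<open>x \<in> S\<close>]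
    by (cases "x \<le> y") (auto simp: divide_le_0_iff)
  then show "\<forall>\<^sub>F y in at x within S. (f y - f x) / (y - x) \<le> 0"
    by (simp add: eventually_at_filter)
qed fact

text \<open>This is the tangent inequality for \<open>f\<close> as a convex function of
  \<open>u\<close>, obtained without inverting \<open>u\<close>. The function
  \<open>f - D x * u\<close> has derivative \<open>(D s - D x) * u' s\<close>, which is nonpositive
  left of \<open>x\<close> and nonnegative right of it, so its minimum is at
  \<open>x\<close>.\<close>

lemma DERIV_mono_ratio_tangent:
  fixes f u D u' :: "real \<Rightarrow> real"
  assumes f: "\<And>t. t \<in> {a..b} \<Longrightarrow> (f has_real_derivative D t * u' t) (at t within {a..b})"
    and u: "\<And>t. t \<in> {a..b} \<Longrightarrow> (u has_real_derivative u' t) (at t within {a..b})"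
    and nonneg: "\<And>t. t \<in> {a..b} \<Longrightarrow> 0 \<le> u' t"
    and mono: "mono_on {a..b} D"
    and x: "x \<in> {a..b}" and t: "t \<in> {a..b}"
  shows "f x + D x * (u t - u x) \<le> f t"
proof -
  let ?h = "\<lambda>s. f s - D x * u s"
  have h: "(?h has_derivative (*) ((D s - D x) * u' s)) (at s within S)"
    if "s \<in> {a..b}" "S \<subseteq> {a..b}" for s S
    using DERIV_subset[OF DERIV_diff[OF f[OF that(1)] DERIV_cmult[OF u[OF that(1)]]] that(2)]
    by (simp add: has_field_derivative_def algebra_simps)
  consider "t < x" | "t = x" | "x < t" by linarith
  then have "?h x \<le> ?h t"
  proof cases
    case 1
    obtain s where s: "s \<in> {t<..<x}" "?h x - ?h t = (D s - D x) * u' s * (x - t)"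
      using mvt_simple[OF 1, of ?h "\<lambda>s. (*) ((D s - D x) * u' s)"] h x t by auto
    then have "D s \<le> D x" "0 \<le> u' s"
      using x t by (auto intro!: monotone_onD[OF mono] nonneg)
    then have "(D s - D x) * u' s * (x - t) \<le> 0"
      using 1 by (intro mult_nonpos_nonneg) auto
    then show ?thesis using s by simp
  next
    case 3
    obtain s where s: "s \<in> {x<..<t}" "?h t - ?h x = (D s - D x) * u' s * (t - x)"
      using mvt_simple[OF 3, of ?h "\<lambda>s. (*) ((D s - D x) * u' s)"] h x t by auto
    then have "D x \<le> D s" "0 \<le> u' s"
      using x t by (auto intro!: monotone_onD[OF mono] nonneg)
    then have "0 \<le> (D s - D x) * u' s * (t - x)"
      using 3 by (intro mult_nonneg_nonneg) auto
    then show ?thesis using s by simp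
  qed simp
  then show ?thesis by (simp add: algebra_simps)
qed

text \<open>The inverse power \<open>1 / p\<close> is at least 1, hence convex. Its midpoint
  inequality at \<open>x powr p\<close> and \<open>y powr p\<close>, raised to the power
  \<open>p\<close>, is the claim.\<close>

lemma powr_midpoint_concave:
  fixes x y p :: real
  assumes "0 < x" "0 < y" "0 < p" "p \<le> 1"
  shows "x powr p + y powr p \<le> 2 * ((x + y) / 2) powr p"
proof -
  have "convex_on {0<..} (\<lambda>z::real. z powr (1 / p))"
    using assms by (intro powr_convex) simp
  from convex_onD[OF this, of "1/2" "x powr p" "y powr p"]
  have "((x powr p + y powr p) / 2) powr (1 / p) \<le> (x + y) / 2"
    using assms by (simp add: powr_powr add_divide_distrib)
  then have "(((x powr p + y powr p) / 2) powr (1 / p)) powr p \<le> ((x + y) / 2) powr p"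
    using assms by (intro powr_mono2) auto
  then show ?thesis
    using assms by (simp add: powr_powr)
qed

text \<open>The lower bound integrates the tangent at \<open>m\<close>, the upper bound the chord
  over \<open>[u a, u b]\<close>, both affine in \<open>u\<close>.\<close>

lemma hermite_hadamard_ratio:
  fixes f u D u' :: "real \<Rightarrow> real"
  assumes "a < b"
    and f: "\<And>t. t \<in> {a..b} \<Longrightarrow> (f has_real_derivative D t * u' t) (at t within {a..b})"
    and u: "\<And>t. t \<in> {a..b} \<Longrightarrow> (u has_real_derivative u' t) (at t within {a..b})"
    and nonneg: "\<And>t. t \<in> {a..b} \<Longrightarrow> 0 \<le> u' t"
    and mono: "mono_on {a..b} D"
    and lt: "u a < u b"
    and m: "m \<in> {a..b}" "D m \<le> 0" and mid: "u a + u b \<le> 2 * u m"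
    and I: "((\<lambda>t. u' t * f t) has_integral I) {a..b}"
  shows "f m * (u b - u a) \<le> I" and "I \<le> (f b + f a - f m) * (u b - u a)"
proof -
  have tangent: "f x + D x * (u t - u x) \<le> f t" if "x \<in> {a..b}" "t \<in> {a..b}" for x t
    using f u nonneg mono that by (rule DERIV_mono_ratio_tangent)
  have int1: "(u' has_integral u b - u a) {a..b}"
    using \<open>a < b\<close> u
    by (intro fundamental_theorem_of_calculus) (auto simp flip: has_real_derivative_iff_has_vector_derivative)
  have "((\<lambda>t. (u t)\<^sup>2 / 2) has_real_derivative u' t * u t) (at t within {a..b})"
    if "t \<in> {a..b}" for t
    using u[OF that] by (auto intro!: derivative_eq_intros)
  then have intu: "((\<lambda>t. u' t * u t) has_integral (u b)\<^sup>2 / 2 - (u a)\<^sup>2 / 2) {a..b}"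
    using \<open>a < b\<close>
    by (intro fundamental_theorem_of_calculus) (auto simp flip: has_real_derivative_iff_has_vector_derivative)
  \<comment> \<open>A function affine in \<open>u\<close>, integrated against \<open>u'\<close>,
    gives its value at the midpoint of \<open>[u a, u b]\<close> times the length
    \<open>u b - u a\<close>.\<close>
  have affine: "((\<lambda>t. u' t * (p + q * u t)) has_integral (p + q * ((u a + u b) / 2)) * (u b - u a)) {a..b}" for p q
  proof -
    have "((\<lambda>t. p * u' t + q * (u' t * u t)) has_integral
            p * (u b - u a) + q * ((u b)\<^sup>2 / 2 - (u a)\<^sup>2 / 2)) {a..b}"
      by (intro has_integral_add has_integral_mult_right int1 intu)
    also have "(\<lambda>t. p * u' t + q * (u' t * u t)) = (\<lambda>t. u' t * (p + q * u t))"
      by (simp add: fun_eq_iff algebra_simps)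
    also have "p * (u b - u a) + q * ((u b)\<^sup>2 / 2 - (u a)\<^sup>2 / 2)
        = (p + q * ((u a + u b) / 2)) * (u b - u a)"
      by (simp add: field_simps power2_eq_square)
    finally show ?thesis .
  qed
  \<comment> \<open>The tangent at \<open>m\<close> has nonpositive slope and the midpoint of
    \<open>[u a, u b]\<close> is at most \<open>u m\<close>, so at that midpoint the tangent is at
    least \<open>f m\<close>.\<close>
  have slope: "0 \<le> D m * ((u a + u b) / 2 - u m)"
    using m mid by (intro mult_nonpos_nonpos) auto
  show "f m * (u b - u a) \<le> I"
  proof -
    have "f m * (u b - u a) \<le> ((f m - D m * u m) + D m * ((u a + u b) / 2)) * (u b - u a)"
      using slope lt by (intro mult_right_mono) (auto simp: algebra_simps)
    also have "\<dots> \<le> I"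
    proof (rule has_integral_le[OF affine I])
      fix t assume t: "t \<in> {a..b}"
      show "u' t * ((f m - D m * u m) + D m * u t) \<le> u' t * f t"
        using tangent[OF m(1) t] by (intro mult_left_mono nonneg[OF t]) (simp add: algebra_simps)
    qed
    finally show ?thesis .
  qed
  \<comment> \<open>Slope of the chord of \<open>f\<close> in the variable \<open>u\<close>.\<close>
  define s where "s = (f b - f a) / (u b - u a)"
  have s: "s * (u b - u a) = f b - f a" using lt by (simp add: s_def)
  have "I \<le> ((f a - s * u a) + s * ((u a + u b) / 2)) * (u b - u a)"
  proof (rule has_integral_le[OF I affine])
    fix t assume t: "t \<in> {a..b}"
    have mono_u: "u x \<le> u y" if xy: "a \<le> x" "x \<le> y" "y \<le> b" for x y
    proof -
      have "(u has_real_derivative u' z) (at z within {x..y})" if "z \<in> {x..y}" for z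
        using that xy by (intro DERIV_subset[OF u]) auto
      then have "(u' has_integral u y - u x) {x..y}"
        using xy by (intro fundamental_theorem_of_calculus)
          (auto simp flip: has_real_derivative_iff_has_vector_derivative)
      then have "0 \<le> u y - u x"
        by (rule has_integral_nonneg) (use xy nonneg in auto)
      then show ?thesis by simp
    qed
    have ut: "0 \<le> u b - u t" "0 \<le> u t - u a"
      using mono_u[of t b] mono_u[of a t] t by simp_all
    \<comment> \<open>The tangent at \<open>t\<close> is evaluated at both endpoints. With the
      weights \<open>u b - u t\<close> and \<open>u t - u a\<close> the terms in \<open>D t\<close>
      cancel in the sum, which leaves the chord bound.\<close>
    have "(u b - u t) * (f t + D t * (u a - u t)) \<le> (u b - u t) * f a"
      by (rule mult_left_mono[OF tangent[OF t] ut(1)]) (use \<open>a < b\<close> in simp)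
    moreover have "(u t - u a) * (f t + D t * (u b - u t)) \<le> (u t - u a) * f b"
      by (rule mult_left_mono[OF tangent[OF t] ut(2)]) (use \<open>a < b\<close> in simp)
    ultimately have "(u b - u a) * f t \<le> (u b - u t) * f a + (u t - u a) * f b"
      by (simp add: algebra_simps)
    also have "\<dots> = (u b - u a) * f a + (u t - u a) * (f b - f a)"
      by (simp add: algebra_simps)
    also have "\<dots> = (u b - u a) * ((f a - s * u a) + s * u t)"
      unfolding s[symmetric] by (simp add: algebra_simps)
    finally have "f t \<le> (f a - s * u a) + s * u t" using lt by simp
    then show "u' t * f t \<le> u' t * ((f a - s * u a) + s * u t)"
      by (intro mult_left_mono nonneg[OF t])
  qed
  also have "(f a - s * u a) + s * ((u a + u b) / 2) = f a + s * (u b - u a) / 2"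
    by (simp add: field_simps)
  also have "\<dots> = (f a + f b) / 2"
    unfolding s by (simp add: field_simps)
  \<comment> \<open>This amounts to \<open>f m \<le> (f a + f b) / 2\<close>, which follows by
    averaging the tangent at \<open>m\<close> over the two endpoints.\<close>
  also have "(f a + f b) / 2 * (u b - u a) \<le> (f b + f a - f m) * (u b - u a)"
  proof (intro mult_right_mono)
    have "D m * (u a - u m) + D m * (u b - u m) = 2 * (D m * ((u a + u b) / 2 - u m))"
      by (simp add: field_simps)
    then have "0 \<le> D m * (u a - u m) + D m * (u b - u m)"
      using slope by simp
    moreover have "f m + D m * (u a - u m) \<le> f a" "f m + D m * (u b - u m) \<le> f b"
      using tangent[OF m(1)] \<open>a < b\<close> by auto
    moreover have "(f a + f b) / 2 \<le> f b + f a - f m"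
      if "0 \<le> p + q" "f m + p \<le> f a" "f m + q \<le> f b" for p q :: real
      using that by simp
    ultimately show "(f a + f b) / 2 \<le> f b + f a - f m" by blast
  qed (use lt in simp)
  finally show "I \<le> (f b + f a - f m) * (u b - u a)" .
qed

theorem mainTheorem9:
  fixes \<beta> a b :: real and f :: "real \<Rightarrow> real"
  assumes "0 < \<beta>" and "\<beta> \<le> 1"
    and "0 \<le> a" and "a < b"
    and "beta_differentiable_on \<beta> {a..b} f"
    and "mono_on {a..b} (beta_deriv \<beta> {a..b} f)"
    and "antimono_on {a..b} f"
  shows "f ((a + b) / 2)
           \<le> \<beta> / ((b + 1 / Gamma \<beta>) powr \<beta> - (a + 1 / Gamma \<beta>) powr \<beta>) * beta_integral \<beta> a b f
       \<and> \<beta> / ((b + 1 / Gamma \<beta>) powr \<beta> - (a + 1 / Gamma \<beta>) powr \<beta>) * beta_integral \<beta> a b f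
           \<le> f b + f a - f ((a + b) / 2)"
proof -
  define c where "c = 1 / Gamma \<beta>"
  define u where "u t = (t + c) powr \<beta>" for t
  define u' where "u' t = \<beta> * (t + c) powr (\<beta> - 1)" for t
  \<comment> \<open>The division by \<beta> offsets the factor \<beta> in \<open>u'\<close>, so that
    the ordinary derivative of \<open>f\<close> is exactly \<open>D t * u' t\<close>.\<close>
  define D where "D t = beta_deriv \<beta> {a..b} f t / \<beta>" for t
  define m where "m = (a + b) / 2"
  have c: "0 < c" using Gamma_real_pos[OF \<open>0 < \<beta>\<close>] by (simp add: c_def)
  have m: "m \<in> {a..b}" using \<open>a < b\<close> by (simp add: m_def field_simps)
  have f: "(f has_real_derivative D t * u' t) (at t within {a..b})" if "t \<in> {a..b}" for t
  proof -
    have "0 < t + 1 / Gamma \<beta>" using that c \<open>0 \<le> a\<close> unfolding c_def[symmetric] by auto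
    moreover have "beta_deriv \<beta> {a..b} f t * (t + 1 / Gamma \<beta>) powr (\<beta> - 1) = D t * u' t"
      using \<open>0 < \<beta>\<close> unfolding D_def u'_def c_def by simp
    ultimately show ?thesis
      using beta_deriv_DERIV[OF assms(5) \<open>a < b\<close> that] by metis
  qed
  have u: "(u has_real_derivative u' t) (at t within {a..b})" if "t \<in> {a..b}" for t
    unfolding u_def u'_def using that c \<open>0 \<le> a\<close> by (auto intro!: derivative_eq_intros)
  have nonneg: "0 \<le> u' t" for t using \<open>0 < \<beta>\<close> by (simp add: u'_def)
  have mono: "mono_on {a..b} D"
    using assms(6) \<open>0 < \<beta>\<close> by (auto simp: D_def monotone_on_def divide_right_mono)
  have lt: "u a < u b"
    unfolding u_def using \<open>a < b\<close> \<open>0 < \<beta>\<close> c \<open>0 \<le> a\<close> by (intro powr_less_mono2) auto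
  \<comment> \<open>The monotonicity of \<open>f\<close> enters only here, to fix the sign of the
    slope at \<open>m\<close>.\<close>
  have "D m * u' m \<le> 0"
    using antimono_on_DERIV_nonpos[OF assms(7) f[OF m] m at_within_Icc_neq_bot[OF \<open>a < b\<close> m]] .
  moreover have "0 < u' m" using m c \<open>0 \<le> a\<close> \<open>0 < \<beta>\<close> by (simp add: u'_def)
  ultimately have Dm: "D m \<le> 0" by (simp add: mult_le_0_iff)
  have mid: "u a + u b \<le> 2 * u m"
    using powr_midpoint_concave[of "a + c" "b + c" \<beta>] assms(1-4) c
    by (simp add: u_def m_def add_divide_distrib algebra_simps)
  let ?J = "beta_integral \<beta> a b f"
  \<comment> \<open>Continuity ensures that \<open>beta_integral\<close> is a genuine integral and
    not the default value 0 of \<open>integral\<close>.\<close>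
  have "continuous_on {a..b} f"
    using f by (rule DERIV_continuous_on)
  then have "continuous_on {a..b} (\<lambda>t. (t + c) powr (\<beta> - 1) * f t)"
    using c \<open>0 \<le> a\<close> by (intro continuous_intros) auto
  then have "((\<lambda>t. (t + c) powr (\<beta> - 1) * f t) has_integral ?J) {a..b}"
    unfolding beta_integral_def c_def by (intro integrable_integral integrable_continuous_real)
  then have I: "((\<lambda>t. u' t * f t) has_integral \<beta> * ?J) {a..b}"
    using has_integral_mult_right[of _ ?J "{a..b}" \<beta>] by (simp add: u'_def mult.assoc)
  have "f m * (u b - u a) \<le> \<beta> * ?J" "\<beta> * ?J \<le> (f b + f a - f m) * (u b - u a)"
    using hermite_hadamard_ratio[OF \<open>a < b\<close> f u nonneg mono lt m Dm mid I] by auto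
  then have "f m \<le> \<beta> / (u b - u a) * ?J \<and> \<beta> / (u b - u a) * ?J \<le> f b + f a - f m"
    using lt by (simp add: pos_le_divide_eq pos_divide_le_eq)
  then show ?thesis by (simp add: u_def c_def m_def)
qed

end
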